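(* Let $\omega_1,\omega_2,\omega_3$ be three distinct circles in the Euclidean plane or in the hyperbolic plane such that each two of them intersect in two distinct points. Let $\ell_{12}$, $\ell_{13}$, $\ell_{23}$ be the straight lines containing the common chords of the corresponding pairs of circles, and assume that these lines pairwise intersect. Then $\ell_{12},\ell_{13},\ell_{23}$ are concurrent, i.e. they have a common point.
   Context: The common chord of two circles intersecting in two points is the segment joining these two points. Absolute geometry is the common part of Euclidean and hyperbolic geometry. *)

theory Defs
  imports "HOL-Analysis.Analysis"
begin

section \<open>The Euclidean plane\<close>

definition euclidean_circle :: "(real^2) set \<Rightarrow> bool" where
  "euclidean_circle \<omega> \<longleftrightarrow> (\<exists>c r. r > 0 \<and> \<omega> = sphere c r)"

definition euclidean_line :: "(real^2) set \<Rightarrow> bool" where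
  "euclidean_line l \<longleftrightarrow> (\<exists>a b. a \<noteq> b \<and> l = affine hull {a, b})"

text \<open>The sets intersect in exactly two points, and \<open>s\<close> is the segment joining these points.\<close>

definition euclidean_common_chord :: "(real^2) set \<Rightarrow> (real^2) set \<Rightarrow> (real^2) set \<Rightarrow> bool" where
  "euclidean_common_chord \<omega> \<omega>' s \<longleftrightarrow>
     (\<exists>a b. a \<noteq> b \<and> \<omega> \<inter> \<omega>' = {a, b} \<and> s = closed_segment a b)"

section \<open>The hyperbolic plane\<close>

text \<open>
  The hyperboloid model, with curvature \<open>-1\<close>: the upper sheet of the unit hyperboloid of the
  Minkowski form. Another curvature only rescales the metric and so has the same
  circles, segments and lines.
\<close>

definition minkowski :: "real^3 \<Rightarrow> real^3 \<Rightarrow> real" where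
  "minkowski x y = x$1 * y$1 + x$2 * y$2 - x$3 * y$3"

definition hyperbolic_plane :: "(real^3) set" where
  "hyperbolic_plane = {x. minkowski x x = -1 \<and> x$3 > 0}"

definition hyperbolic_dist :: "real^3 \<Rightarrow> real^3 \<Rightarrow> real" where
  "hyperbolic_dist x y = arcosh (- minkowski x y)"

definition hyperbolic_circle :: "(real^3) set \<Rightarrow> bool" where
  "hyperbolic_circle \<omega> \<longleftrightarrow>
     (\<exists>c\<in>hyperbolic_plane. \<exists>r>0. \<omega> = {x\<in>hyperbolic_plane. hyperbolic_dist c x = r})"

text \<open>
  The geodesics of the hyperboloid are its sections by planes through the origin.
\<close>

definition hyperbolic_line :: "(real^3) set \<Rightarrow> bool" where
  "hyperbolic_line l \<longleftrightarrow>
     (\<exists>a\<in>hyperbolic_plane. \<exists>b\<in>hyperbolic_plane. a \<noteq> b \<and> l = hyperbolic_plane \<inter> span {a, b})"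

definition hyperbolic_segment :: "real^3 \<Rightarrow> real^3 \<Rightarrow> (real^3) set" where
  "hyperbolic_segment a b =
     {x\<in>hyperbolic_plane. hyperbolic_dist a x + hyperbolic_dist x b = hyperbolic_dist a b}"

definition hyperbolic_common_chord :: "(real^3) set \<Rightarrow> (real^3) set \<Rightarrow> (real^3) set \<Rightarrow> bool" where
  "hyperbolic_common_chord \<omega> \<omega>' s \<longleftrightarrow>
     (\<exists>a b. a \<noteq> b \<and> \<omega> \<inter> \<omega>' = {a, b} \<and> s = hyperbolic_segment a b)"

text \<open>
  Well-definedness: on the hyperbolic plane \<^const>\<open>arcosh\<close> is applied to arguments at least 1,
  \<^const>\<open>hyperbolic_dist\<close> is a metric, and segments are contained in lines.
\<close>

lemma hyperbolic_third:
  assumes "x \<in> hyperbolic_plane"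
  shows "x$3 = sqrt (1 + (x$1)\<^sup>2 + (x$2)\<^sup>2)"
  using assms unfolding hyperbolic_plane_def minkowski_def
  by (intro real_sqrt_unique[symmetric]) (auto simp: power2_eq_square)

lemma minkowski_le:
  assumes x: "x \<in> hyperbolic_plane" and y: "y \<in> hyperbolic_plane"
  shows "1 \<le> - minkowski x y"
proof -
  have "1 + x$1 * y$1 + x$2 * y$2 \<le> \<bar>1 + x$1 * y$1 + x$2 * y$2\<bar>" by simp
  also have "\<dots> = sqrt ((1 + x$1 * y$1 + x$2 * y$2)\<^sup>2)" by simp
  also have "\<dots> \<le> sqrt ((1 + (x$1)\<^sup>2 + (x$2)\<^sup>2) * (1 + (y$1)\<^sup>2 + (y$2)\<^sup>2))"
  proof (rule real_sqrt_le_mono)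
    have "(1 + (x$1)\<^sup>2 + (x$2)\<^sup>2) * (1 + (y$1)\<^sup>2 + (y$2)\<^sup>2) - (1 + x$1 * y$1 + x$2 * y$2)\<^sup>2
        = (x$1 - y$1)\<^sup>2 + (x$2 - y$2)\<^sup>2 + (x$1 * y$2 - x$2 * y$1)\<^sup>2" by algebra
    then show "(1 + x$1 * y$1 + x$2 * y$2)\<^sup>2
        \<le> (1 + (x$1)\<^sup>2 + (x$2)\<^sup>2) * (1 + (y$1)\<^sup>2 + (y$2)\<^sup>2)"
      by (smt (verit) zero_le_power2)
  qed
  also have "\<dots> = x$3 * y$3"
    by (simp add: hyperbolic_third[OF x] hyperbolic_third[OF y] real_sqrt_mult)
  finally show ?thesis by (simp add: minkowski_def)
qed

lemma minkowski_eq_iff: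
  assumes x: "x \<in> hyperbolic_plane" and y: "y \<in> hyperbolic_plane"
  shows "minkowski x y = -1 \<longleftrightarrow> x = y"
proof
  assume eq: "minkowski x y = -1"
  have xx: "minkowski x x = -1" and yy: "minkowski y y = -1" using x y by (auto simp: hyperbolic_plane_def)
  have "(1 + (x$1)\<^sup>2 + (x$2)\<^sup>2) * (1 + (y$1)\<^sup>2 + (y$2)\<^sup>2) = (x$3)\<^sup>2 * (y$3)\<^sup>2"
    using xx yy unfolding minkowski_def by (simp add: power2_eq_square algebra_simps)
  moreover have "x$3 * y$3 = 1 + x$1 * y$1 + x$2 * y$2" using eq by (simp add: minkowski_def)
  ultimately have "(x$1 - y$1)\<^sup>2 + (x$2 - y$2)\<^sup>2 + (x$1 * y$2 - x$2 * y$1)\<^sup>2 = 0" by algebra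
  then have "x$1 = y$1 \<and> x$2 = y$2"
    by (smt (verit) power2_eq_iff zero_le_power2 zero_eq_power2)
  moreover from this have "x$3 = y$3" using hyperbolic_third[OF x] hyperbolic_third[OF y] by simp
  ultimately show "x = y" by (simp add: vec_eq_iff forall_3)
qed (use x in \<open>simp add: hyperbolic_plane_def\<close>)

lemma minkowski_gram:
  assumes "x \<in> hyperbolic_plane" "y \<in> hyperbolic_plane" "z \<in> hyperbolic_plane"
  shows "(minkowski x z + minkowski x y * minkowski y z)\<^sup>2
    = ((minkowski x y)\<^sup>2 - 1) * ((minkowski y z)\<^sup>2 - 1) - (det (vector [x, y, z] :: real^3^3))\<^sup>2"
proof -
  have "x$1 * x$1 + x$2 * x$2 - x$3 * x$3 = -1" "y$1 * y$1 + y$2 * y$2 - y$3 * y$3 = -1"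
    "z$1 * z$1 + z$2 * z$2 - z$3 * z$3 = -1"
    using assms by (auto simp: hyperbolic_plane_def minkowski_def)
  then show ?thesis unfolding minkowski_def det_3 vector_3 by algebra
qed

lemma cosh_hyperbolic_dist_add:
  assumes "x \<in> hyperbolic_plane" "y \<in> hyperbolic_plane" "z \<in> hyperbolic_plane"
  shows "cosh (hyperbolic_dist x y + hyperbolic_dist y z)
    = minkowski x y * minkowski y z + sqrt (((minkowski x y)\<^sup>2 - 1) * ((minkowski y z)\<^sup>2 - 1))"
  unfolding hyperbolic_dist_def
  using minkowski_le assms by (simp add: cosh_add sinh_arcosh_real real_sqrt_mult)

lemma hyperbolic_dist_nonneg:
  "x \<in> hyperbolic_plane \<Longrightarrow> y \<in> hyperbolic_plane \<Longrightarrow> 0 \<le> hyperbolic_dist x y"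
  unfolding hyperbolic_dist_def using minkowski_le by simp

lemma hyperbolic_dist_commute: "hyperbolic_dist x y = hyperbolic_dist y x"
  by (simp add: hyperbolic_dist_def minkowski_def mult.commute)

lemma hyperbolic_dist_eq_0_iff:
  "x \<in> hyperbolic_plane \<Longrightarrow> y \<in> hyperbolic_plane \<Longrightarrow> hyperbolic_dist x y = 0 \<longleftrightarrow> x = y"
  unfolding hyperbolic_dist_def using minkowski_le minkowski_eq_iff by fastforce

lemma hyperbolic_dist_triangle:
  assumes "x \<in> hyperbolic_plane" "y \<in> hyperbolic_plane" "z \<in> hyperbolic_plane"
  shows "hyperbolic_dist x z \<le> hyperbolic_dist x y + hyperbolic_dist y z"
proof -
  have "- minkowski x z - minkowski x y * minkowski y z \<le> sqrt ((minkowski x z + minkowski x y * minkowski y z)\<^sup>2)"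
    by simp
  also have "\<dots> \<le> sqrt (((minkowski x y)\<^sup>2 - 1) * ((minkowski y z)\<^sup>2 - 1))"
    unfolding minkowski_gram[OF assms] by (rule real_sqrt_le_mono) simp
  finally have "cosh (hyperbolic_dist x z) \<le> cosh (hyperbolic_dist x y + hyperbolic_dist y z)"
    unfolding cosh_hyperbolic_dist_add[OF assms]
    using minkowski_le[of x z] assms by (simp add: hyperbolic_dist_def)
  then show ?thesis
    using hyperbolic_dist_nonneg assms by (simp add: cosh_real_nonneg_le_iff)
qed

lemma hyperbolic_segment_subset:
  assumes a: "a \<in> hyperbolic_plane" and b: "b \<in> hyperbolic_plane" and "a \<noteq> b"
  shows "hyperbolic_segment a b \<subseteq> hyperbolic_plane \<inter> span {a, b}"
proof
  fix x assume "x \<in> hyperbolic_segment a b"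
  then have x: "x \<in> hyperbolic_plane" and eq: "hyperbolic_dist a x + hyperbolic_dist x b = hyperbolic_dist a b"
    by (auto simp: hyperbolic_segment_def)
  let ?S = "((minkowski a x)\<^sup>2 - 1) * ((minkowski x b)\<^sup>2 - 1)"
  have "cosh (hyperbolic_dist a b) = minkowski a x * minkowski x b + sqrt ?S"
    using cosh_hyperbolic_dist_add[OF a x b] eq by simp
  then have "- (minkowski a b + minkowski a x * minkowski x b) = sqrt ?S"
    using minkowski_le[OF a b] by (simp add: hyperbolic_dist_def)
  moreover have "0 \<le> ?S"
    using minkowski_le[OF a x] minkowski_le[OF x b]
    by (intro mult_nonneg_nonneg) (smt (verit) one_le_power power2_minus)+
  ultimately have "(minkowski a b + minkowski a x * minkowski x b)\<^sup>2 = ?S"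
    by (metis power2_minus real_sqrt_pow2)
  then have "det (vector [a, x, b] :: real^3^3) = 0"
    using minkowski_gram[OF a x b] by simp
  then have dep: "a$1*(x$2*b$3 - x$3*b$2) - a$2*(x$1*b$3 - x$3*b$1) + a$3*(x$1*b$2 - x$2*b$1) = 0"
    by (simp add: det_3 algebra_simps)
  let ?ab = "minkowski a b" and ?ax = "minkowski a x" and ?bx = "minkowski b x"
  have aa: "a$1*a$1 + a$2*a$2 - a$3*a$3 = -1" and bb: "b$1*b$1 + b$2*b$2 - b$3*b$3 = -1"
    using a b by (auto simp: hyperbolic_plane_def minkowski_def)
  have "(?ab\<^sup>2 - 1) *\<^sub>R x = (?ax + ?ab * ?bx) *\<^sub>R a + (?bx + ?ab * ?ax) *\<^sub>R b"
    unfolding vec_eq_iff forall_3 minkowski_def using aa bb dep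
    by simp (intro conjI; algebra)
  moreover have "?ab\<^sup>2 - 1 \<noteq> 0"
    using minkowski_le[OF a b] minkowski_eq_iff[OF a b] \<open>a \<noteq> b\<close> by (auto simp: power2_eq_1_iff)
  ultimately have "x = (1 / (?ab\<^sup>2 - 1)) *\<^sub>R ((?ax + ?ab * ?bx) *\<^sub>R a + (?bx + ?ab * ?ax) *\<^sub>R b)"
    by (metis divide_self_if scaleR_one scaleR_scaleR times_divide_eq_left mult_1)
  moreover have "\<dots> \<in> span {a, b}"
    by (intro span_scale span_add) (auto intro: span_base)
  ultimately show "x \<in> hyperbolic_plane \<inter> span {a, b}" using x by simp
qed

end

theory Submission
  imports Defs
begin

text \<open>
  Each chord line is a radical axis. In the Euclidean plane a circle is given by
  \<open>x \<bullet> x = c \<bullet> x + k\<close>, and the line through the common points of two circles is the locus where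
  the two affine functions \<open>c \<bullet> x + k\<close> agree. On the hyperboloid a circle is the section by an affine
  plane \<open>\<langle>g, x\<rangle> = -1\<close>, and the line through the common points of two circles is the locus where
  the two linear functions \<open>\<langle>g, x\<rangle>\<close> agree. In both cases a point of two chord lines is one
  where all three functions agree, so it lies on the third.
\<close>

text \<open>Expanding the squared distance to the centre leaves \<open>x \<bullet> x\<close> as the
  only quadratic term. It is the same for all circles, so it cancels when two such equations are
  compared.\<close>

lemma euclidean_circle_equation:
  assumes "euclidean_circle \<omega>"
  obtains c k where "\<omega> = {x. x \<bullet> x = c \<bullet> x + k}"
proof -
  from assms obtain c r where r: "r > 0" and \<omega>: "\<omega> = sphere c r"
    unfolding euclidean_circle_def by auto
  have "dist c x = r \<longleftrightarrow> x \<bullet> x = (2 *\<^sub>R c) \<bullet> x + (r\<^sup>2 - c \<bullet> c)" for x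
  proof -
    \<comment> \<open>Both sides are nonnegative, so squaring is reversible.\<close>
    have "dist c x = r \<longleftrightarrow> (dist c x)\<^sup>2 = r\<^sup>2"
      using r by (simp add: power2_eq_iff_nonneg)
    also have "(dist c x)\<^sup>2 = c \<bullet> c - 2 * (c \<bullet> x) + x \<bullet> x"
      by (simp add: dist_norm power2_norm_eq_inner inner_diff inner_commute)
    finally show ?thesis by auto
  qed
  with \<omega> that[of "2 *\<^sub>R c" "r\<^sup>2 - c \<bullet> c"] show ?thesis by (auto simp: sphere_def)
qed

text \<open>In the plane both a line and a hyperplane are affine sets of dimension 1. Each contains
  the affine hull of the two distinct points \<open>a\<close> and \<open>b\<close>, which has
  dimension 1 as well, so each equals it.\<close>

lemma euclidean_line_eq_hyperplane:
  fixes a b n :: "real^2"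
  assumes l: "euclidean_line l" and "a \<in> l" "b \<in> l" "a \<noteq> b"
    and n: "n \<noteq> 0" "n \<bullet> a = d" "n \<bullet> b = d"
  shows "l = {x. n \<bullet> x = d}"
proof -
  let ?H = "{x. n \<bullet> x = d}"
  from l obtain u v where uv: "u \<noteq> v" "l = affine hull {u, v}"
    unfolding euclidean_line_def by auto
  have "aff_dim (affine hull {a, b}) = 1" "aff_dim l = 1" "aff_dim ?H = 1"
    using uv n \<open>a \<noteq> b\<close> by (simp_all add: aff_dim_affine_hull aff_dim_2 aff_dim_hyperplane)
  moreover have "affine l" "affine ?H"
    using uv by (simp_all add: affine_hyperplane)
  moreover have "affine hull {a, b} \<subseteq> l" "affine hull {a, b} \<subseteq> ?H"
    using assms \<open>affine l\<close> \<open>affine ?H\<close> by (simp_all add: hull_minimal)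
  ultimately show ?thesis
    by (metis affine_affine_hull affine_dim_equal affine_hull_eq_empty insert_not_empty)
qed

lemma euclidean_chord_line_eq_radical_axis:
  assumes \<omega>: "\<omega> = {x. x \<bullet> x = c \<bullet> x + k}" and \<omega>': "\<omega>' = {x. x \<bullet> x = c' \<bullet> x + k'}"
    and "\<omega> \<noteq> \<omega>'" and s: "euclidean_common_chord \<omega> \<omega>' s"
    and l: "euclidean_line l" "s \<subseteq> l"
  shows "l = {x. c \<bullet> x + k = c' \<bullet> x + k'}"
proof -
  from s obtain a b where "a \<noteq> b" and ab: "\<omega> \<inter> \<omega>' = {a, b}" and "s = closed_segment a b"
    unfolding euclidean_common_chord_def by auto
  then have in_l: "a \<in> l" "b \<in> l" using l by auto
  have "a \<in> \<omega>" "a \<in> \<omega>'" "b \<in> \<omega>" "b \<in> \<omega>'" using ab by auto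
  then have a: "c \<bullet> a + k = c' \<bullet> a + k'" and b: "c \<bullet> b + k = c' \<bullet> b + k'"
    using \<omega> \<omega>' by auto
  \<comment> \<open>Distinct concentric circles are disjoint: if \<open>c = c'\<close>, the common
    point \<open>a\<close> forces \<open>k = k'\<close>, and the circles coincide.\<close>
  have "c - c' \<noteq> 0" using a \<omega> \<omega>' \<open>\<omega> \<noteq> \<omega>'\<close> by auto
  then have "l = {x. (c - c') \<bullet> x = k' - k}"
    using a b by (intro euclidean_line_eq_hyperplane[OF l(1) in_l \<open>a \<noteq> b\<close>])
      (auto simp: inner_diff_left)
  then show ?thesis by (auto simp: inner_diff_left)
qed

lemma minkowski_diff_left: "minkowski (x - y) z = minkowski x z - minkowski y z"
  by (simp add: minkowski_def algebra_simps)

text \<open>Flipping the sign of the third coordinate turns a Minkowski orthogonal complement into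
  an ordinary hyperplane, whose dimension is known.\<close>

lemma minkowski_eq_inner: "minkowski n x = vector [n$1, n$2, - n$3] \<bullet> x"
  by (simp add: minkowski_def inner_vec_def sum_3)

text \<open>For a circle with centre \<open>c\<close> and radius \<open>r\<close> the equation is
  \<open>minkowski c x = - cosh r\<close>. Dividing by \<open>cosh r\<close> makes the constant -1
  for every circle, so the difference of two circle equations is homogeneous and describes a plane
  through the origin.\<close>

lemma hyperbolic_circle_equation:
  assumes "hyperbolic_circle \<omega>"
  obtains g where "\<omega> = {x\<in>hyperbolic_plane. minkowski g x = -1}"
proof -
  from assms obtain c r where c: "c \<in> hyperbolic_plane" and r: "r > 0"
    and \<omega>: "\<omega> = {x\<in>hyperbolic_plane. hyperbolic_dist c x = r}"
    unfolding hyperbolic_circle_def by auto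
  have "hyperbolic_dist c x = r \<longleftrightarrow> minkowski ((1 / cosh r) *\<^sub>R c) x = -1"
    if x: "x \<in> hyperbolic_plane" for x
  proof -
    \<comment> \<open>Here \<open>cosh\<close> and \<open>arcosh\<close> are mutually inverse, since
      \<open>- minkowski c x\<close> is at least 1 and \<open>r\<close> is positive.\<close>
    have "hyperbolic_dist c x = r \<longleftrightarrow> - minkowski c x = cosh r"
      unfolding hyperbolic_dist_def using minkowski_le[OF c x] r
      by (metis arcosh_cosh_real cosh_arcosh_real less_imp_le)
    moreover have "minkowski ((1 / cosh r) *\<^sub>R c) x = minkowski c x / cosh r"
      by (simp add: minkowski_def field_simps)
    moreover have "minkowski c x / cosh r = -1 \<longleftrightarrow> minkowski c x = - cosh r"
      by (simp add: divide_eq_eq)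
    ultimately show ?thesis by linarith
  qed
  with \<omega> that[of "(1 / cosh r) *\<^sub>R c"] show ?thesis by auto
qed

text \<open>A line through the origin meets the hyperboloid in at most two opposite points, and only
  one of them is on the upper sheet.\<close>

lemma hyperbolic_plane_independent:
  assumes a: "a \<in> hyperbolic_plane" and b: "b \<in> hyperbolic_plane" and "a \<noteq> b"
  shows "independent {a, b}"
proof -
  have "b \<noteq> 0" using b by (auto simp: hyperbolic_plane_def)
  moreover have "a \<notin> span {b}"
  proof
    assume "a \<in> span {b}"
    then obtain t where t: "a = t *\<^sub>R b" by (auto simp: span_singleton)
    have "minkowski a a = t\<^sup>2 * minkowski b b"
      by (simp add: t minkowski_def power2_eq_square algebra_simps)
    then have "t\<^sup>2 = 1" using a b by (simp add: hyperbolic_plane_def)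
    \<comment> \<open>The third coordinates of \<open>a\<close> and \<open>b\<close> are both
      positive, which excludes \<open>t = -1\<close>.\<close>
    moreover have "t > 0"
      using a b by (auto simp: t hyperbolic_plane_def zero_less_mult_iff)
    ultimately have "t = 1" by (auto simp: power2_eq_1_iff)
    with t \<open>a \<noteq> b\<close> show False by simp
  qed
  ultimately show ?thesis using \<open>a \<noteq> b\<close> by (simp add: independent_insert)
qed

text \<open>The span defining the line and the Minkowski complement of \<open>n\<close> are both
  two-dimensional subspaces containing the two-dimensional \<open>span {a, b}\<close>. Hence they
  coincide, and so do their sections of the hyperboloid.\<close>

lemma hyperbolic_line_eq_plane_section:
  assumes l: "hyperbolic_line l" and "a \<in> l" "b \<in> l" "a \<noteq> b"
    and n: "n \<noteq> 0" "minkowski n a = 0" "minkowski n b = 0"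
  shows "l = {x\<in>hyperbolic_plane. minkowski n x = 0}"
proof -
  let ?H = "{x. minkowski n x = 0}"
  let ?n = "vector [n$1, n$2, - n$3] :: real^3"
  from l obtain u v where uv: "u \<in> hyperbolic_plane" "v \<in> hyperbolic_plane" "u \<noteq> v"
    "l = hyperbolic_plane \<inter> span {u, v}"
    unfolding hyperbolic_line_def by auto
  have ab: "a \<in> hyperbolic_plane" "b \<in> hyperbolic_plane" using assms(2,3) uv by auto
  have "?n \<noteq> 0" using n(1) by (auto simp: vec_eq_iff forall_3)
  then have "dim ?H = 2" "subspace ?H"
    unfolding minkowski_eq_inner by (simp_all add: dim_hyperplane subspace_hyperplane)
  moreover have "dim (span {x, y}) = 2"
    if "x \<in> hyperbolic_plane" "y \<in> hyperbolic_plane" "x \<noteq> y" for x y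
    using dim_span_eq_card_independent[OF hyperbolic_plane_independent[OF that]] \<open>x \<noteq> y\<close> by simp
  moreover have "span {a, b} \<subseteq> span {u, v}" "span {a, b} \<subseteq> ?H"
    using assms(2,3) uv(4) n \<open>subspace ?H\<close> by (intro span_minimal; force)+
  ultimately have "span {u, v} = ?H"
    using uv(1-3) ab \<open>a \<noteq> b\<close>
    by (metis subspace_dim_equal subspace_span order_refl)
  then show ?thesis using uv(4) by auto
qed

text \<open>Segments are defined by equality in the triangle inequality, so the endpoints belong to
  them because a point has distance 0 from itself. This puts the common points of two circles on the
  line containing their chord.\<close>

lemma hyperbolic_segment_endpoints:
  assumes "a \<in> hyperbolic_plane" "b \<in> hyperbolic_plane"
  shows "a \<in> hyperbolic_segment a b" "b \<in> hyperbolic_segment a b"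
  using assms hyperbolic_dist_eq_0_iff by (auto simp: hyperbolic_segment_def)

lemma hyperbolic_chord_line_eq_radical_axis:
  assumes \<omega>: "\<omega> = {x\<in>hyperbolic_plane. minkowski g x = -1}"
    and \<omega>': "\<omega>' = {x\<in>hyperbolic_plane. minkowski g' x = -1}"
    and "\<omega> \<noteq> \<omega>'" and s: "hyperbolic_common_chord \<omega> \<omega>' s"
    and l: "hyperbolic_line l" "s \<subseteq> l"
  shows "l = {x\<in>hyperbolic_plane. minkowski g x = minkowski g' x}"
proof -
  from s obtain a b where "a \<noteq> b" and ab: "\<omega> \<inter> \<omega>' = {a, b}" and "s = hyperbolic_segment a b"
    unfolding hyperbolic_common_chord_def by auto
  have "a \<in> \<omega>" "a \<in> \<omega>'" "b \<in> \<omega>" "b \<in> \<omega>'" using ab by auto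
  then have "a \<in> hyperbolic_plane" "b \<in> hyperbolic_plane"
    and a: "minkowski g a = minkowski g' a" and b: "minkowski g b = minkowski g' b"
    using \<omega> \<omega>' by auto
  then have in_l: "a \<in> l" "b \<in> l"
    using l \<open>s = _\<close> hyperbolic_segment_endpoints by auto
  \<comment> \<open>Both equations have the constant -1, so \<open>g = g'\<close> would make the
    circles equal.\<close>
  have "g - g' \<noteq> 0" using \<omega> \<omega>' \<open>\<omega> \<noteq> \<omega>'\<close> by auto
  then have "l = {x\<in>hyperbolic_plane. minkowski (g - g') x = 0}"
    using a b by (intro hyperbolic_line_eq_plane_section[OF l(1) in_l \<open>a \<noteq> b\<close>])
      (auto simp: minkowski_diff_left)
  then show ?thesis by (auto simp: minkowski_diff_left)
qed

theorem mainTheorem4: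
  shows
    "(\<forall>\<omega>\<^sub>1 \<omega>\<^sub>2 \<omega>\<^sub>3 s\<^sub>1\<^sub>2 s\<^sub>1\<^sub>3 s\<^sub>2\<^sub>3 l\<^sub>1\<^sub>2 l\<^sub>1\<^sub>3 l\<^sub>2\<^sub>3.
        euclidean_circle \<omega>\<^sub>1 \<and> euclidean_circle \<omega>\<^sub>2 \<and> euclidean_circle \<omega>\<^sub>3 \<and>
        \<omega>\<^sub>1 \<noteq> \<omega>\<^sub>2 \<and> \<omega>\<^sub>1 \<noteq> \<omega>\<^sub>3 \<and> \<omega>\<^sub>2 \<noteq> \<omega>\<^sub>3 \<and>
        euclidean_common_chord \<omega>\<^sub>1 \<omega>\<^sub>2 s\<^sub>1\<^sub>2 \<and>
        euclidean_common_chord \<omega>\<^sub>1 \<omega>\<^sub>3 s\<^sub>1\<^sub>3 \<and>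
        euclidean_common_chord \<omega>\<^sub>2 \<omega>\<^sub>3 s\<^sub>2\<^sub>3 \<and>
        euclidean_line l\<^sub>1\<^sub>2 \<and> s\<^sub>1\<^sub>2 \<subseteq> l\<^sub>1\<^sub>2 \<and>
        euclidean_line l\<^sub>1\<^sub>3 \<and> s\<^sub>1\<^sub>3 \<subseteq> l\<^sub>1\<^sub>3 \<and>
        euclidean_line l\<^sub>2\<^sub>3 \<and> s\<^sub>2\<^sub>3 \<subseteq> l\<^sub>2\<^sub>3 \<and>
        l\<^sub>1\<^sub>2 \<inter> l\<^sub>1\<^sub>3 \<noteq> {} \<and> l\<^sub>1\<^sub>2 \<inter> l\<^sub>2\<^sub>3 \<noteq> {} \<and> l\<^sub>1\<^sub>3 \<inter> l\<^sub>2\<^sub>3 \<noteq> {}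
        \<longrightarrow> (\<exists>p. p \<in> l\<^sub>1\<^sub>2 \<and> p \<in> l\<^sub>1\<^sub>3 \<and> p \<in> l\<^sub>2\<^sub>3)) \<and>
     (\<forall>\<omega>\<^sub>1 \<omega>\<^sub>2 \<omega>\<^sub>3 s\<^sub>1\<^sub>2 s\<^sub>1\<^sub>3 s\<^sub>2\<^sub>3 l\<^sub>1\<^sub>2 l\<^sub>1\<^sub>3 l\<^sub>2\<^sub>3.
        hyperbolic_circle \<omega>\<^sub>1 \<and> hyperbolic_circle \<omega>\<^sub>2 \<and> hyperbolic_circle \<omega>\<^sub>3 \<and>
        \<omega>\<^sub>1 \<noteq> \<omega>\<^sub>2 \<and> \<omega>\<^sub>1 \<noteq> \<omega>\<^sub>3 \<and> \<omega>\<^sub>2 \<noteq> \<omega>\<^sub>3 \<and>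
        hyperbolic_common_chord \<omega>\<^sub>1 \<omega>\<^sub>2 s\<^sub>1\<^sub>2 \<and>
        hyperbolic_common_chord \<omega>\<^sub>1 \<omega>\<^sub>3 s\<^sub>1\<^sub>3 \<and>
        hyperbolic_common_chord \<omega>\<^sub>2 \<omega>\<^sub>3 s\<^sub>2\<^sub>3 \<and>
        hyperbolic_line l\<^sub>1\<^sub>2 \<and> s\<^sub>1\<^sub>2 \<subseteq> l\<^sub>1\<^sub>2 \<and>
        hyperbolic_line l\<^sub>1\<^sub>3 \<and> s\<^sub>1\<^sub>3 \<subseteq> l\<^sub>1\<^sub>3 \<and>
        hyperbolic_line l\<^sub>2\<^sub>3 \<and> s\<^sub>2\<^sub>3 \<subseteq> l\<^sub>2\<^sub>3 \<and>
        l\<^sub>1\<^sub>2 \<inter> l\<^sub>1\<^sub>3 \<noteq> {} \<and> l\<^sub>1\<^sub>2 \<inter> l\<^sub>2\<^sub>3 \<noteq> {} \<and> l\<^sub>1\<^sub>3 \<inter> l\<^sub>2\<^sub>3 \<noteq> {}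
        \<longrightarrow> (\<exists>p. p \<in> l\<^sub>1\<^sub>2 \<and> p \<in> l\<^sub>1\<^sub>3 \<and> p \<in> l\<^sub>2\<^sub>3))"
proof (intro conjI allI impI, goal_cases)
  case (1 \<omega>\<^sub>1 \<omega>\<^sub>2 \<omega>\<^sub>3 s\<^sub>1\<^sub>2 s\<^sub>1\<^sub>3 s\<^sub>2\<^sub>3 l\<^sub>1\<^sub>2 l\<^sub>1\<^sub>3 l\<^sub>2\<^sub>3)
  then have circles: "euclidean_circle \<omega>\<^sub>1" "euclidean_circle \<omega>\<^sub>2" "euclidean_circle \<omega>\<^sub>3" by blast+
  obtain c1 k1 where \<omega>\<^sub>1: "\<omega>\<^sub>1 = {x. x \<bullet> x = c1 \<bullet> x + k1}"
    by (rule euclidean_circle_equation[OF circles(1)])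
  obtain c2 k2 where \<omega>\<^sub>2: "\<omega>\<^sub>2 = {x. x \<bullet> x = c2 \<bullet> x + k2}"
    by (rule euclidean_circle_equation[OF circles(2)])
  obtain c3 k3 where \<omega>\<^sub>3: "\<omega>\<^sub>3 = {x. x \<bullet> x = c3 \<bullet> x + k3}"
    by (rule euclidean_circle_equation[OF circles(3)])
  have l\<^sub>1\<^sub>2: "l\<^sub>1\<^sub>2 = {x. c1 \<bullet> x + k1 = c2 \<bullet> x + k2}"
    by (rule euclidean_chord_line_eq_radical_axis[OF \<omega>\<^sub>1 \<omega>\<^sub>2, where s = s\<^sub>1\<^sub>2]) (use 1 in blast)+
  have l\<^sub>1\<^sub>3: "l\<^sub>1\<^sub>3 = {x. c1 \<bullet> x + k1 = c3 \<bullet> x + k3}"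
    by (rule euclidean_chord_line_eq_radical_axis[OF \<omega>\<^sub>1 \<omega>\<^sub>3, where s = s\<^sub>1\<^sub>3]) (use 1 in blast)+
  have l\<^sub>2\<^sub>3: "l\<^sub>2\<^sub>3 = {x. c2 \<bullet> x + k2 = c3 \<bullet> x + k3}"
    by (rule euclidean_chord_line_eq_radical_axis[OF \<omega>\<^sub>2 \<omega>\<^sub>3, where s = s\<^sub>2\<^sub>3]) (use 1 in blast)+
  \<comment> \<open>Radical axes of circles with collinear centres may be parallel; the assumption
    that the lines meet supplies \<open>p\<close>.\<close>
  from 1 obtain p where "p \<in> l\<^sub>1\<^sub>2" "p \<in> l\<^sub>1\<^sub>3" by auto
  then show ?case using l\<^sub>1\<^sub>2 l\<^sub>1\<^sub>3 l\<^sub>2\<^sub>3 by auto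
next
  case (2 \<omega>\<^sub>1 \<omega>\<^sub>2 \<omega>\<^sub>3 s\<^sub>1\<^sub>2 s\<^sub>1\<^sub>3 s\<^sub>2\<^sub>3 l\<^sub>1\<^sub>2 l\<^sub>1\<^sub>3 l\<^sub>2\<^sub>3)
  then have circles: "hyperbolic_circle \<omega>\<^sub>1" "hyperbolic_circle \<omega>\<^sub>2" "hyperbolic_circle \<omega>\<^sub>3" by blast+
  obtain g1 where \<omega>\<^sub>1: "\<omega>\<^sub>1 = {x\<in>hyperbolic_plane. minkowski g1 x = -1}"
    by (rule hyperbolic_circle_equation[OF circles(1)])
  obtain g2 where \<omega>\<^sub>2: "\<omega>\<^sub>2 = {x\<in>hyperbolic_plane. minkowski g2 x = -1}"
    by (rule hyperbolic_circle_equation[OF circles(2)])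
  obtain g3 where \<omega>\<^sub>3: "\<omega>\<^sub>3 = {x\<in>hyperbolic_plane. minkowski g3 x = -1}"
    by (rule hyperbolic_circle_equation[OF circles(3)])
  have l\<^sub>1\<^sub>2: "l\<^sub>1\<^sub>2 = {x\<in>hyperbolic_plane. minkowski g1 x = minkowski g2 x}"
    by (rule hyperbolic_chord_line_eq_radical_axis[OF \<omega>\<^sub>1 \<omega>\<^sub>2, where s = s\<^sub>1\<^sub>2]) (use 2 in blast)+
  have l\<^sub>1\<^sub>3: "l\<^sub>1\<^sub>3 = {x\<in>hyperbolic_plane. minkowski g1 x = minkowski g3 x}"
    by (rule hyperbolic_chord_line_eq_radical_axis[OF \<omega>\<^sub>1 \<omega>\<^sub>3, where s = s\<^sub>1\<^sub>3]) (use 2 in blast)+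
  have l\<^sub>2\<^sub>3: "l\<^sub>2\<^sub>3 = {x\<in>hyperbolic_plane. minkowski g2 x = minkowski g3 x}"
    by (rule hyperbolic_chord_line_eq_radical_axis[OF \<omega>\<^sub>2 \<omega>\<^sub>3, where s = s\<^sub>2\<^sub>3]) (use 2 in blast)+
  \<comment> \<open>Two planes through the origin always share a nonzero vector, but its multiples
    may all miss the hyperboloid. The assumption that the lines meet supplies a genuine point of the
    hyperbolic plane.\<close>
  from 2 obtain p where "p \<in> l\<^sub>1\<^sub>2" "p \<in> l\<^sub>1\<^sub>3" by auto
  then show ?case using l\<^sub>1\<^sub>2 l\<^sub>1\<^sub>3 l\<^sub>2\<^sub>3 by auto
qed

end
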